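(* Let $0\le k\le n$ be integers and $m=\min(k,n-k)$. Then \[P(n,k)\le 2^{n-2}\left(\left(k-\frac m2-\frac74\right)^2+\frac{9k}{2}+\frac{79}{16}\right)+2^k\left(\frac32\right)^m\left(\frac k2-\frac m6\right)-2^k(k+1)-2^{n-k}\left(\frac32\right)^m.\]
   Context: For a power of two $M$ let $O(M)=\frac M4(\log_2^2M-\log_2M+4)-1$ (the size of Batcher's odd-even sorting network on $M$ inputs). For powers of two $1\le K\le N$ define $H(N,K)$, the number of comparators of the improved pairwise selection network $pw\_hbit\_sel^N_K$, by $H(N,1)=N-1$; $H(N,N)=O(N)$ for $N>1$; and $H(N,K)=H(N/2,K)+H(N/2,K/2)+\frac N2+\frac{K\log_2K}{2}$ for $1<K<N$. Set $P(n,k)=H(2^n,2^k)$. *)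

theory Defs
  imports Complex_Main
begin

definition oe_sort_size :: "nat \<Rightarrow> real" where
  "oe_sort_size M = real M / 4 * ((log 2 (real M))\<^sup>2 - log 2 (real M) + 4) - 1"

(* Only meaningful when N and K are powers of two with 1 <= K <= N; the recursive calls
   stay in this domain and all divisions by 2 are then exact. The first equation that
   applies wins, so K = N = 1 gives N - 1 = 0; the last branch is a junk value. *)
function pw_hbit_sel_size :: "nat \<Rightarrow> nat \<Rightarrow> real" where
  "pw_hbit_sel_size N K =
     (if K = 1 then real N - 1
      else if K = N then oe_sort_size N
      else if 1 < K \<and> K < N then
        pw_hbit_sel_size (N div 2) K + pw_hbit_sel_size (N div 2) (K div 2)
          + real N / 2 + real K * log 2 (real K) / 2
      else 0)"
  by pat_completeness auto
termination
  by (relation "measure fst") auto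

declare pw_hbit_sel_size.simps [simp del]

definition P :: "nat \<Rightarrow> nat \<Rightarrow> real" where
  "P n k = pw_hbit_sel_size (2 ^ n) (2 ^ k)"

end

theory Submission
  imports Defs
begin

text \<open>
  Write \<open>n = k + j\<close>. In these coordinates the recursion goes from \<open>(k, j)\<close> to \<open>(k, j - 1)\<close> and
  \<open>(k - 1, j)\<close>, and the claimed bound is exact on the boundary \<open>k = 0\<close> or \<open>j = 0\<close>. It also satisfies
  the recursion exactly on the diagonal \<open>j = k\<close>. Off the diagonal it is a supersolution of the
  recursion: the defect is an explicit combination of powers of \<open>2\<close> and \<open>3/2\<close> whose leading term
  has the right sign as soon as the smaller coordinate is at least \<open>4\<close> (below the diagonal
  \<open>j < k\<close>) or \<open>3\<close> (above it), and small cases are computed.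
\<close>

lemma P_0: "P n 0 = 2 ^ n - 1"
  by (simp add: P_def pw_hbit_sel_size.simps)

text \<open>For \<open>k = 0\<close> the branch \<open>K = 1\<close> fires first, but the sorting
  formula gives the same value 0.\<close>

lemma P_same: "P k k = 2 ^ k / 4 * ((real k)\<^sup>2 - real k + 4) - 1"
proof (cases "k = 0")
  case True
  then show ?thesis by (simp add: P_0)
next
  case False
  then show ?thesis
    by (simp add: P_def pw_hbit_sel_size.simps oe_sort_size_def log_nat_power)
qed

lemma P_Suc_Suc:
  "P (Suc k + Suc j) (Suc k) =
     P (Suc k + j) (Suc k) + P (k + Suc j) k + 2 ^ k * 2 ^ j * 2 + 2 ^ k * (real k + 1)"
proof -
  have "(2::nat) ^ Suc k < 2 ^ (Suc k + Suc j)" "(1::nat) < 2 ^ Suc k"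
    by (intro power_strict_increasing one_less_power; simp)+
  moreover have "(2::nat) ^ (Suc k + Suc j) div 2 = 2 ^ (Suc k + j)"
    "(2::nat) ^ Suc k div 2 = 2 ^ k"
    by simp_all
  moreover have "log 2 (real (2 ^ Suc k)) = real k + 1"
    by (simp add: log_nat_power del: power_Suc)
  ultimately have "P (Suc k + Suc j) (Suc k) =
     P (Suc k + j) (Suc k) + P (Suc k + j) k + real (2 ^ (Suc k + Suc j)) / 2
       + real (2 ^ Suc k) * (real k + 1) / 2"
    unfolding P_def
    by (subst pw_hbit_sel_size.simps) (simp del: power_Suc power_add of_nat_power)
  then show ?thesis
    by (simp add: power_add)
qed

text \<open>The claimed right-hand side with \<open>n = k + j\<close>. The minimum is a separate
  argument \<open>m\<close>, so that each step lemma can insert its known value and become free of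
  \<open>min\<close>.\<close>

definition bound :: "nat \<Rightarrow> nat \<Rightarrow> nat \<Rightarrow> real" where
  "bound k j m =
     2 ^ k * 2 ^ j / 4 * ((real k - real m / 2 - 7 / 4)\<^sup>2 + 9 * real k / 2 + 79 / 16)
       + 2 ^ k * (3 / 2) ^ m * (real k / 2 - real m / 6)
       - 2 ^ k * (real k + 1) - 2 ^ j * (3 / 2) ^ m"

lemma bound_step_diagonal:
  "bound (Suc k) k k + bound k (Suc k) k + 2 ^ k * 2 ^ k * 2 + 2 ^ k * (real k + 1)
     = bound (Suc k) (Suc k) (Suc k)"
  by (simp add: bound_def power2_eq_square field_simps)

text \<open>Left side minus right side, times \<open>2 ^ k\<close>, is the defect of
  \<open>bound\<close> at the point \<open>(k, j)\<close> reached by a recursion step below the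
  diagonal.\<close>

lemma defect_below_nonpos:
  assumes "1 \<le> j" "j < k"
  shows "2 ^ j * (5 - 2 * real k + real j) / 16 + (3 / 2) ^ j * (3 * real k - real j - 5) / 36
           \<le> 3 ^ j / (3 * 2 ^ k)" (is "?lhs \<le> _")
proof -
  have pos: "0 < (3::real) ^ j / (3 * 2 ^ k)" by simp
  \<comment> \<open>The positive right side is needed only for \<open>(j, k)\<close> = (1,2), (1,3),
    (2,3), (2,4), (3,4); elsewhere \<open>?lhs\<close> is already at most 0.\<close>
  consider "j = 1" | "j = 2" | "j = 3" | "4 \<le> j" using assms by linarith
  then show ?thesis
  proof cases
    case 1
    consider "k = 2" | "k = 3" | "4 \<le> k" using assms 1 by linarith
    then show ?thesis
    proof cases
      case 3
      then have "?lhs \<le> 0" using 1 by (simp add: field_simps)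
      with pos show ?thesis by linarith
    qed (use 1 in simp_all)
  next
    case 2
    consider "k = 3" | "k = 4" | "5 \<le> k" using assms 2 by linarith
    then show ?thesis
    proof cases
      case 3
      then have "?lhs \<le> 0" using 2 by (simp add: field_simps)
      with pos show ?thesis by linarith
    qed (use 2 in \<open>simp_all add: power2_eq_square\<close>)
  next
    case 3
    consider "k = 4" | "5 \<le> k" using assms 3 by linarith
    then show ?thesis
    proof cases
      case 2
      then have "?lhs \<le> 0" using 3 by (simp add: field_simps)
      with pos show ?thesis by linarith
    qed (use 3 in \<open>simp_all add: power3_eq_cube\<close>)
  next
    case 4
    have "3 \<le> (4 / 3 :: real) ^ 4" by (simp add: power_divide)
    also have "\<dots> \<le> (4 / 3) ^ j"
      using 4 by (intro power_increasing) auto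
    finally have r: "3 \<le> (4 / 3 :: real) ^ j" .
    have kj: "real j + 1 \<le> real k" "4 \<le> real j" using assms 4 by auto
    \<comment> \<open>In the worst case \<open>k = j + 1\<close> this reads
      \<open>73 \<le> 19 * j\<close>, which holds from \<open>j = 4\<close> on.\<close>
    have "(3 * real k - real j - 5) / 36 \<le> 3 * ((2 * real k - real j - 5) / 16)"
      using kj by simp
    also have "\<dots> \<le> (4 / 3) ^ j * ((2 * real k - real j - 5) / 16)"
      using kj by (intro mult_right_mono r) simp
    finally have "(3 / 2) ^ j * ((3 * real k - real j - 5) / 36)
        \<le> (3 / 2) ^ j * ((4 / 3) ^ j * ((2 * real k - real j - 5) / 16))"
      by (intro mult_left_mono) auto
    also have "\<dots> = 2 ^ j * ((2 * real k - real j - 5) / 16)"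
      by (simp add: power_mult_distrib [symmetric] mult.assoc [symmetric])
    finally have "?lhs \<le> 0"
      by (simp add: algebra_simps diff_divide_distrib add_divide_distrib)
    with pos show ?thesis by linarith
  qed
qed

lemma bound_step_below:
  assumes "j < k"
  shows "bound (Suc k) j j + bound k (Suc j) (Suc j) + 2 ^ k * 2 ^ j * 2 + 2 ^ k * (real k + 1)
           \<le> bound (Suc k) (Suc j) (Suc j)"
proof -
  let ?K = "Suc k" and ?J = "Suc j"
  \<comment> \<open>Reduces all terms to monomials in \<open>2 ^ k\<close>, \<open>2 ^ j\<close> and
    \<open>(3 / 2) ^ j\<close>, so that the defect identity becomes linear algebra.\<close>
  have pow: "(3::real) ^ j = (3 / 2) ^ j * 2 ^ j"
    by (simp add: power_mult_distrib [symmetric])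
  have "bound ?K j j + bound k ?J ?J + 2 ^ k * 2 ^ j * 2 + 2 ^ k * (real k + 1)
          - bound ?K ?J ?J
      = 2 ^ ?K * (2 ^ ?J * (5 - 2 * real ?K + real ?J) / 16
          + (3 / 2) ^ ?J * (3 * real ?K - real ?J - 5) / 36 - 3 ^ ?J / (3 * 2 ^ ?K))"
    by (simp add: bound_def power2_eq_square pow)
      (simp add: algebra_simps add_divide_distrib diff_divide_distrib)
  also have "\<dots> \<le> 0"
    using defect_below_nonpos [of ?J ?K] assms
    by (intro mult_nonneg_nonpos) (auto simp del: power_Suc of_nat_Suc)
  finally show ?thesis by simp
qed

lemma defect_above_nonpos:
  assumes "1 \<le> k" "k < j"
  shows "2 ^ k * (3 - real k) / 16 + 3 ^ k * (real k - 1) / (9 * 2 ^ j) \<le> (3 / 2) ^ k / 6"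
proof -
  \<comment> \<open>Only one term depends on \<open>j\<close>, and it decreases, so
    \<open>j = k + 1\<close> is the worst case.\<close>
  have "(2::real) ^ Suc k \<le> 2 ^ j"
    using assms by (intro power_increasing) auto
  then have "3 ^ k * (real k - 1) / (9 * 2 ^ j) \<le> 3 ^ k * (real k - 1) / (9 * 2 ^ Suc k)"
    using assms by (intro divide_left_mono) auto
  also have "\<dots> = (3 / 2) ^ k * ((real k - 1) / 18)"
    by (simp add: power_divide)
  finally have le: "3 ^ k * (real k - 1) / (9 * 2 ^ j) \<le> (3 / 2) ^ k * ((real k - 1) / 18)" .
  consider "k = 1" | "k = 2" | "3 \<le> k" using assms by linarith
  then have "2 ^ k * ((3 - real k) / 16) + (3 / 2) ^ k * ((real k - 1) / 18) \<le> (3 / 2) ^ k / 6"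
  proof cases
    case 3
    \<comment> \<open>The numerator \<open>k - 4\<close> is \<open>k - 1\<close> minus 3, the right
      side being \<open>(3 / 2) ^ k * (3 / 18)\<close>.\<close>
    have "(real k - 4) / 18 \<le> 1 * ((real k - 3) / 16)"
      using 3 by simp
    also have "\<dots> \<le> (4 / 3) ^ k * ((real k - 3) / 16)"
      using 3 by (intro mult_right_mono) auto
    finally have "(3 / 2) ^ k * ((real k - 4) / 18)
        \<le> (3 / 2) ^ k * ((4 / 3) ^ k * ((real k - 3) / 16))"
      by (intro mult_left_mono) auto
    also have "\<dots> = 2 ^ k * ((real k - 3) / 16)"
      by (simp add: power_mult_distrib [symmetric] mult.assoc [symmetric])
    finally show ?thesis by (simp add: algebra_simps diff_divide_distrib)
  qed (simp_all add: power2_eq_square)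
  with le show ?thesis by (simp only: times_divide_eq_right)
qed

lemma bound_step_above:
  assumes "k < j"
  shows "bound (Suc k) j (Suc k) + bound k (Suc j) k + 2 ^ k * 2 ^ j * 2 + 2 ^ k * (real k + 1)
           \<le> bound (Suc k) (Suc j) (Suc k)"
proof -
  let ?K = "Suc k" and ?J = "Suc j"
  have pow: "(3::real) ^ k = (3 / 2) ^ k * 2 ^ k"
    by (simp add: power_mult_distrib [symmetric])
  have "bound ?K j ?K + bound k ?J k + 2 ^ k * 2 ^ j * 2 + 2 ^ k * (real k + 1)
          - bound ?K ?J ?K
      = 2 ^ ?J * (2 ^ ?K * (3 - real ?K) / 16 + 3 ^ ?K * (real ?K - 1) / (9 * 2 ^ ?J)
          - (3 / 2) ^ ?K / 6)"
    by (simp add: bound_def power2_eq_square pow)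
      (simp add: algebra_simps add_divide_distrib diff_divide_distrib)
  also have "\<dots> \<le> 0"
    using defect_above_nonpos [of ?K ?J] assms
    by (intro mult_nonneg_nonpos) (auto simp del: power_Suc of_nat_Suc)
  finally show ?thesis by simp
qed

lemma P_le_bound: "P (k + j) k \<le> bound k j (min k j)"
proof (induction "k + j" arbitrary: k j)
  case 0
  then show ?case by (simp add: P_0 bound_def power2_eq_square)
next
  case (Suc n)
  show ?case
  proof (cases "k = 0 \<or> j = 0")
    case True
    then show ?thesis
      \<comment> \<open>Equality holds here with \<open>m = 0\<close>; the constants fit since 49/16
        + 79/16 = 8.\<close>
      by (auto simp: P_0 P_same bound_def power2_eq_square field_simps)
  next
    case False
    then obtain k' j' where kj: "k = Suc k'" "j = Suc j'"
      by (meson not0_implies_Suc)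
    have IH: "P (Suc k' + j') (Suc k') \<le> bound (Suc k') j' (min (Suc k') j')"
      "P (k' + Suc j') k' \<le> bound k' (Suc j') (min k' (Suc j'))"
      using Suc kj by (metis add_Suc add_Suc_right Suc_inject)+
    have "bound (Suc k') j' (min (Suc k') j') + bound k' (Suc j') (min k' (Suc j'))
        + 2 ^ k' * 2 ^ j' * 2 + 2 ^ k' * (real k' + 1)
        \<le> bound (Suc k') (Suc j') (min (Suc k') (Suc j'))"
    \<comment> \<open>The order of \<open>k'\<close> and \<open>j'\<close> fixes all three
      minima.\<close>
    proof (cases k' j' rule: linorder_cases)
      case less
      then show ?thesis using bound_step_above [of k' j'] by (simp add: min_def)
    next
      case equal
      then show ?thesis using bound_step_diagonal [of k'] by (simp add: min_def)
    next
      case greater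
      then show ?thesis using bound_step_below [of j' k'] by (simp add: min_absorb2)
    qed
    with IH show ?thesis unfolding kj P_Suc_Suc by linarith
  qed
qed

theorem theorem4:
  fixes n k m :: nat
  assumes "k \<le> n" and "m = min k (n - k)"
  shows "P n k \<le>
    2 powi (int n - 2) * ((real k - real m / 2 - 7 / 4)\<^sup>2 + 9 * real k / 2 + 79 / 16)
    + 2 ^ k * (3 / 2) ^ m * (real k / 2 - real m / 6)
    - 2 ^ k * (real k + 1)
    - 2 ^ (n - k) * (3 / 2) ^ m"
proof -
  \<comment> \<open>The exponent is an integer because it is negative for
    \<open>n < 2\<close>.\<close>
  have "2 powi (int n - 2) = (2::real) ^ n / 4"
    by (simp add: power_int_diff)
  also have "\<dots> = 2 ^ k * 2 ^ (n - k) / 4"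
    using assms(1) by (simp add: power_add [symmetric])
  finally have "2 powi (int n - 2) = (2::real) ^ k * 2 ^ (n - k) / 4" .
  moreover have "P n k \<le> bound k (n - k) m"
    using P_le_bound [of k "n - k"] assms by simp
  ultimately show ?thesis
    by (simp only: bound_def)
qed

end
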